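(* Let $(A,[\cdot,\cdot],\rhd,\alpha,\beta)$ be a regular BiHom-post-Lie algebra over $\mathbb{K}$. Then the bracket $$\{x,y\}=x\rhd y-\alpha^{-1}\beta(y)\rhd\alpha\beta^{-1}(x)+[x,y],\qquad x,y\in A,$$ defines a BiHom-Lie algebra structure on $A$, i.e. $(A,\{\cdot,\cdot\},\alpha,\beta)$ is a BiHom-Lie algebra.
   Context: All vector spaces are over a field $\mathbb{K}$ of characteristic zero. A BiHom-Lie algebra $(A,[\cdot,\cdot],\alpha,\beta)$ is a vector space $A$ with a bilinear bracket $[\cdot,\cdot]:A\times A\to A$ and linear maps $\alpha,\beta:A\to A$ such that for all $x,y,z$: $\alpha\beta=\beta\alpha$; $\alpha([x,y])=[\alpha(x),\alpha(y)]$, $\beta([x,y])=[\beta(x),\beta(y)]$; $[\beta(x),\alpha(y)]=-[\beta(y),\alpha(x)]$; and $[\beta^2(x),[\beta(y),\alpha(z)]]+[\beta^2(y),[\beta(z),\alpha(x)]]+[\beta^2(z),[\beta(x),\alpha(y)]]=0$. A BiHom-post-Lie algebra $(A,[\cdot,\cdot],\rhd,\alpha,\beta)$ is a BiHom-Lie algebra $(A,[\cdot,\cdot],\alpha,\beta)$ together with a bilinear product $\rhd:A\times A\to A$ such that for all $x,y,z\in A$: $\alpha(x\rhd y)=\alpha(x)\rhd\alpha(y)$, $\beta(x\rhd y)=\beta(x)\rhd\beta(y)$; $\alpha\beta(x)\rhd[y,z]=[\beta(x)\rhd y,\beta(z)]+[\beta(y),\alpha(x)\rhd z]$; and $[\beta(x),\alpha(y)]\rhd\beta(z)=as_{\alpha,\beta}(\beta(x),\alpha(y),z)-as_{\alpha,\beta}(\beta(y),\alpha(x),z)$,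 where $as_{\alpha,\beta}(x,y,z)=\alpha(x)\rhd(y\rhd z)-(x\rhd y)\rhd\beta(z)$. It is regular if $\alpha$ and $\beta$ are bijective. *)

theory Defs
  imports Complex_Main
begin

text \<open>
  The library's \<open>bilinear\<close> is restricted to real vector spaces; this is the same notion
  over an arbitrary field.
\<close>

definition bilinear_map ::
    "('k::field \<Rightarrow> 'a::ab_group_add \<Rightarrow> 'a) \<Rightarrow> ('a \<Rightarrow> 'a \<Rightarrow> 'a) \<Rightarrow> bool" where
  "bilinear_map scale m \<longleftrightarrow>
     (\<forall>x. Vector_Spaces.linear scale scale (\<lambda>y. m x y)) \<and>
     (\<forall>y. Vector_Spaces.linear scale scale (\<lambda>x. m x y))"

locale bihom_lie_algebra = vector_space scale
  for scale :: "'k::field_char_0 \<Rightarrow> 'a::ab_group_add \<Rightarrow> 'a"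
    and bracket :: "'a \<Rightarrow> 'a \<Rightarrow> 'a"
    and \<alpha> :: "'a \<Rightarrow> 'a"
    and \<beta> :: "'a \<Rightarrow> 'a" +
  assumes bilinear_bracket: "bilinear_map scale bracket"
    and linear_alpha: "Vector_Spaces.linear scale scale \<alpha>"
    and linear_beta: "Vector_Spaces.linear scale scale \<beta>"
    and alpha_beta_commute: "\<alpha> (\<beta> x) = \<beta> (\<alpha> x)"
    and alpha_bracket: "\<alpha> (bracket x y) = bracket (\<alpha> x) (\<alpha> y)"
    and beta_bracket: "\<beta> (bracket x y) = bracket (\<beta> x) (\<beta> y)"
    and bihom_skew_symmetry: "bracket (\<beta> x) (\<alpha> y) = - bracket (\<beta> y) (\<alpha> x)"
    and bihom_jacobi:
      "bracket (\<beta> (\<beta> x)) (bracket (\<beta> y) (\<alpha> z))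
       + bracket (\<beta> (\<beta> y)) (bracket (\<beta> z) (\<alpha> x))
       + bracket (\<beta> (\<beta> z)) (bracket (\<beta> x) (\<alpha> y)) = 0"

definition bihom_associator ::
    "('a::ab_group_add \<Rightarrow> 'a \<Rightarrow> 'a) \<Rightarrow> ('a \<Rightarrow> 'a) \<Rightarrow> ('a \<Rightarrow> 'a) \<Rightarrow> 'a \<Rightarrow> 'a \<Rightarrow> 'a \<Rightarrow> 'a" where
  "bihom_associator m \<alpha> \<beta> x y z = m (\<alpha> x) (m y z) - m (m x y) (\<beta> z)"

locale bihom_post_lie_algebra = bihom_lie_algebra scale bracket \<alpha> \<beta>
  for scale :: "'k::field_char_0 \<Rightarrow> 'a::ab_group_add \<Rightarrow> 'a"
    and bracket :: "'a \<Rightarrow> 'a \<Rightarrow> 'a"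
    and rhd :: "'a \<Rightarrow> 'a \<Rightarrow> 'a"  (infixl "\<rhd>" 70)
    and \<alpha> :: "'a \<Rightarrow> 'a"
    and \<beta> :: "'a \<Rightarrow> 'a" +
  assumes bilinear_rhd: "bilinear_map scale rhd"
    and alpha_rhd: "\<alpha> (x \<rhd> y) = \<alpha> x \<rhd> \<alpha> y"
    and beta_rhd: "\<beta> (x \<rhd> y) = \<beta> x \<rhd> \<beta> y"
    and rhd_bracket:
      "\<alpha> (\<beta> x) \<rhd> bracket y z = bracket (\<beta> x \<rhd> y) (\<beta> z) + bracket (\<beta> y) (\<alpha> x \<rhd> z)"
    and bracket_rhd:
      "bracket (\<beta> x) (\<alpha> y) \<rhd> \<beta> z =
         bihom_associator rhd \<alpha> \<beta> (\<beta> x) (\<alpha> y) z - bihom_associator rhd \<alpha> \<beta> (\<beta> y) (\<alpha> x) z"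

locale regular_bihom_post_lie_algebra = bihom_post_lie_algebra scale bracket rhd \<alpha> \<beta>
  for scale :: "'k::field_char_0 \<Rightarrow> 'a::ab_group_add \<Rightarrow> 'a"
    and bracket :: "'a \<Rightarrow> 'a \<Rightarrow> 'a"
    and rhd :: "'a \<Rightarrow> 'a \<Rightarrow> 'a"  (infixl "\<rhd>" 70)
    and \<alpha> :: "'a \<Rightarrow> 'a"
    and \<beta> :: "'a \<Rightarrow> 'a" +
  assumes bij_alpha: "bij \<alpha>"
    and bij_beta: "bij \<beta>"

end

theory Submission
  imports Defs
begin

text \<open>
  Regularity makes it possible to remove the twisting maps. Put
  \<open>[x, y]' = [\<alpha>\<inverse> x, \<beta>\<inverse> y]\<close> and \<open>x \<rhd>' y = \<alpha>\<inverse> x \<rhd> \<beta>\<inverse> y\<close>. Since \<open>\<alpha>\<close> and \<open>\<beta>\<close> commute and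
  respect both products, every BiHom identity turns into the corresponding untwisted identity
  evaluated at images of the variables under monomials in \<open>\<alpha>\<close> and \<open>\<beta>\<close>. Because such monomials are
  surjective, \<open>(A, [\<cdot>,\<cdot>]', \<rhd>')\<close> is a post-Lie algebra in the usual sense
  (\<open>post_lie_algebra_untwist\<close>), on which \<open>\<alpha>\<close> and \<open>\<beta>\<close> are commuting endomorphisms.

  The classical fact that \<open>\<lbrace>x, y\<rbrace>' = x \<rhd>' y - y \<rhd>' x + [x, y]'\<close> is a Lie bracket
  (\<open>lie_algebra_sub_adjacent\<close>) then applies. Twisting a Lie bracket back by commuting
  endomorphisms gives a BiHom-Lie algebra (\<open>bihom_lie_algebra_twist\<close>), and
  \<open>\<lbrace>\<alpha> x, \<beta> y\<rbrace>' = x \<rhd> y - \<alpha>\<inverse>\<beta> y \<rhd> \<alpha>\<beta>\<inverse> x + [x, y]\<close> is exactly the bracket of the theorem: the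
  unexpected factors \<open>\<alpha>\<inverse>\<beta>\<close> and \<open>\<alpha>\<beta>\<inverse>\<close> are what swapping the two arguments of \<open>\<rhd>'\<close> costs in
  terms of \<open>\<rhd>\<close>.
\<close>

section \<open>Bilinear maps\<close>

lemma bilinear_map_iff:
  assumes "vector_space scale"
  shows "bilinear_map scale m \<longleftrightarrow>
    (\<forall>x y z. m x (y + z) = m x y + m x z) \<and> (\<forall>x y z. m (x + y) z = m x z + m y z) \<and>
    (\<forall>c x y. m x (scale c y) = scale c (m x y)) \<and> (\<forall>c x y. m (scale c x) y = scale c (m x y))"
  unfolding bilinear_map_def Vector_Spaces.linear_iff using assms by blast

lemma bilinear_map_compose:
  assumes "bilinear_map scale m"
    and "Vector_Spaces.linear scale scale f" and "Vector_Spaces.linear scale scale g"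
  shows "bilinear_map scale (\<lambda>x y. m (f x) (g y))"
proof -
  have "vector_space scale"
    using assms(2) by (simp add: Vector_Spaces.linear_iff)
  then show ?thesis
    using assms by (simp add: bilinear_map_iff Vector_Spaces.linear_iff)
qed

context
  fixes scale :: "'k::field \<Rightarrow> 'a::ab_group_add \<Rightarrow> 'a" and m :: "'a \<Rightarrow> 'a \<Rightarrow> 'a"
  assumes vs: "vector_space scale" and bil: "bilinear_map scale m"
begin

lemma bilinear_map_add_right: "m x (y + z) = m x y + m x z"
  and bilinear_map_add_left: "m (x + y) z = m x z + m y z"
  using bil by (simp_all add: bilinear_map_iff[OF vs])

lemma bilinear_map_diff_right: "m x (y - z) = m x y - m x z"
  by (metis add_diff_cancel diff_add_cancel bilinear_map_add_right)

lemma bilinear_map_diff_left: "m (x - y) z = m x z - m y z"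
  by (metis add_diff_cancel diff_add_cancel bilinear_map_add_left)

end

lemma linear_inv_of_bij:
  assumes "Vector_Spaces.linear scale scale f" and "bij f"
  shows "Vector_Spaces.linear scale scale (inv f)"
proof -
  have "inv f (x + y) = inv f x + inv f y" for x y
    using assms by (intro inv_f_eq) (auto simp: Vector_Spaces.linear_iff bij_is_inj bij_is_surj surj_f_inv_f)
  moreover have "inv f (scale c x) = scale c (inv f x)" for c x
    using assms by (intro inv_f_eq) (auto simp: Vector_Spaces.linear_iff bij_is_inj bij_is_surj surj_f_inv_f)
  ultimately show ?thesis
    using assms(1) by (simp add: Vector_Spaces.linear_iff)
qed

section \<open>Lie and post-Lie algebras\<close>

locale lie_algebra = vector_space scale
  for scale :: "'k::field_char_0 \<Rightarrow> 'a::ab_group_add \<Rightarrow> 'a"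
    and bracket :: "'a \<Rightarrow> 'a \<Rightarrow> 'a" +
  assumes bilinear_bracket: "bilinear_map scale bracket"
    and skew_symmetry: "bracket x y = - bracket y x"
    and jacobi: "bracket x (bracket y z) + bracket y (bracket z x) + bracket z (bracket x y) = 0"

locale post_lie_algebra = lie_algebra scale bracket
  for scale :: "'k::field_char_0 \<Rightarrow> 'a::ab_group_add \<Rightarrow> 'a"
    and bracket :: "'a \<Rightarrow> 'a \<Rightarrow> 'a"
    and rhd :: "'a \<Rightarrow> 'a \<Rightarrow> 'a"  (infixl "\<rhd>" 70) +
  assumes bilinear_rhd: "bilinear_map scale rhd"
    and rhd_bracket: "x \<rhd> bracket y z = bracket (x \<rhd> y) z + bracket y (x \<rhd> z)"
    and bracket_rhd:
      "bracket x y \<rhd> z = (x \<rhd> (y \<rhd> z) - (x \<rhd> y) \<rhd> z) - (y \<rhd> (x \<rhd> z) - (y \<rhd> x) \<rhd> z)"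
begin

definition sub_adjacent :: "'a \<Rightarrow> 'a \<Rightarrow> 'a" where
  "sub_adjacent x y = x \<rhd> y - y \<rhd> x + bracket x y"

lemmas bracket_simps =
  bilinear_map_add_right[OF vector_space_axioms bilinear_bracket]
  bilinear_map_add_left[OF vector_space_axioms bilinear_bracket]
  bilinear_map_diff_right[OF vector_space_axioms bilinear_bracket]
  bilinear_map_diff_left[OF vector_space_axioms bilinear_bracket]

lemmas rhd_simps =
  bilinear_map_add_right[OF vector_space_axioms bilinear_rhd]
  bilinear_map_add_left[OF vector_space_axioms bilinear_rhd]
  bilinear_map_diff_right[OF vector_space_axioms bilinear_rhd]
  bilinear_map_diff_left[OF vector_space_axioms bilinear_rhd]

text \<open>
  This is the meaning of the axiom \<open>bracket_rhd\<close>: left multiplication is a representation of the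
  bracket \<open>sub_adjacent\<close>.
\<close>

lemma sub_adjacent_rhd: "sub_adjacent x y \<rhd> z = x \<rhd> (y \<rhd> z) - y \<rhd> (x \<rhd> z)"
  by (simp add: sub_adjacent_def rhd_simps bracket_rhd)

text \<open>
  Expanding one summand of the Jacobi identity leaves, apart from the corresponding summand for the
  original bracket, two kinds of terms, double \<open>\<rhd>\<close>-products and brackets containing one
  \<open>\<rhd>\<close>-product. The form on the right makes both cancel under cyclic permutation.
\<close>

lemma sub_adjacent_nested:
  "sub_adjacent x (sub_adjacent y z) =
     (x \<rhd> (y \<rhd> z) - x \<rhd> (z \<rhd> y) - y \<rhd> (z \<rhd> x) + z \<rhd> (y \<rhd> x))
     + (bracket (x \<rhd> y) z - bracket (x \<rhd> z) y + bracket (z \<rhd> y) x - bracket (y \<rhd> z) x)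
     + bracket x (bracket y z)"
proof -
  have "sub_adjacent x (sub_adjacent y z) =
      x \<rhd> sub_adjacent y z - sub_adjacent y z \<rhd> x + bracket x (sub_adjacent y z)"
    by (simp add: sub_adjacent_def)
  also have "x \<rhd> sub_adjacent y z =
      x \<rhd> (y \<rhd> z) - x \<rhd> (z \<rhd> y) + bracket (x \<rhd> y) z - bracket (x \<rhd> z) y"
    by (simp add: sub_adjacent_def rhd_simps rhd_bracket skew_symmetry[of y "x \<rhd> z"])
  also have "bracket x (sub_adjacent y z) =
      bracket (z \<rhd> y) x - bracket (y \<rhd> z) x + bracket x (bracket y z)"
    by (simp add: sub_adjacent_def bracket_simps
        skew_symmetry[of x "y \<rhd> z"] skew_symmetry[of x "z \<rhd> y"])
  finally show ?thesis
    by (simp add: sub_adjacent_rhd algebra_simps)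
qed

lemma lie_algebra_sub_adjacent: "lie_algebra scale sub_adjacent"
proof
  show "bilinear_map scale sub_adjacent"
    using bilinear_bracket bilinear_rhd
    by (simp add: bilinear_map_iff[OF vector_space_axioms] sub_adjacent_def
        scale_right_distrib scale_right_diff_distrib)
  show "sub_adjacent x y = - sub_adjacent y x" for x y
    by (simp add: sub_adjacent_def skew_symmetry[of x y])
  show "sub_adjacent x (sub_adjacent y z) + sub_adjacent y (sub_adjacent z x)
      + sub_adjacent z (sub_adjacent x y) = 0" for x y z
    using jacobi[of x y z] by (simp add: sub_adjacent_nested algebra_simps)
qed

end

section \<open>Twisting and untwisting\<close>

text \<open>
  The identities hold because both arguments of \<open>[\<beta> x, \<alpha> y]\<close> acquire the same factor \<open>\<alpha>\<beta>\<close> after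
  twisting, and the three arguments of \<open>[\<beta>\<^sup>2 x, [\<beta> y, \<alpha> z]]\<close> the same factor \<open>\<alpha>\<beta>\<^sup>2\<close>.
\<close>

lemma (in lie_algebra) bihom_lie_algebra_twist:
  assumes "Vector_Spaces.linear scale scale \<alpha>" and "Vector_Spaces.linear scale scale \<beta>"
    and comm: "\<And>x. \<alpha> (\<beta> x) = \<beta> (\<alpha> x)"
    and \<alpha>: "\<And>x y. \<alpha> (bracket x y) = bracket (\<alpha> x) (\<alpha> y)"
    and \<beta>: "\<And>x y. \<beta> (bracket x y) = bracket (\<beta> x) (\<beta> y)"
  shows "bihom_lie_algebra scale (\<lambda>x y. bracket (\<alpha> x) (\<beta> y)) \<alpha> \<beta>"
proof
  show "bilinear_map scale (\<lambda>x y. bracket (\<alpha> x) (\<beta> y))"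
    using bilinear_bracket assms(1,2) by (rule bilinear_map_compose)
  show "bracket (\<alpha> (\<beta> x)) (\<beta> (\<alpha> y)) = - bracket (\<alpha> (\<beta> y)) (\<beta> (\<alpha> x))" for x y
    unfolding comm by (rule skew_symmetry)
  show "bracket (\<alpha> (\<beta> (\<beta> x))) (\<beta> (bracket (\<alpha> (\<beta> y)) (\<beta> (\<alpha> z))))
      + bracket (\<alpha> (\<beta> (\<beta> y))) (\<beta> (bracket (\<alpha> (\<beta> z)) (\<beta> (\<alpha> x))))
      + bracket (\<alpha> (\<beta> (\<beta> z))) (\<beta> (bracket (\<alpha> (\<beta> x)) (\<beta> (\<alpha> y)))) = 0" for x y z
    using jacobi by (simp add: comm \<beta>)
qed (use assms(1,2) in \<open>auto simp: Vector_Spaces.linear_iff \<alpha> \<beta> comm\<close>)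

context regular_bihom_post_lie_algebra
begin

definition untwist :: "('a \<Rightarrow> 'a \<Rightarrow> 'a) \<Rightarrow> 'a \<Rightarrow> 'a \<Rightarrow> 'a" where
  "untwist m x y = m (inv \<alpha> x) (inv \<beta> y)"

lemma inv_alpha [simp]: "inv \<alpha> (\<alpha> x) = x" "\<alpha> (inv \<alpha> x) = x"
  and inv_beta [simp]: "inv \<beta> (\<beta> x) = x" "\<beta> (inv \<beta> x) = x"
  using bij_alpha bij_beta by (simp_all add: bij_is_inj bij_is_surj surj_f_inv_f)

lemma inv_alpha_beta: "inv \<alpha> (\<beta> x) = \<beta> (inv \<alpha> x)"
  by (metis inv_alpha alpha_beta_commute)

lemma inv_beta_alpha: "inv \<beta> (\<alpha> x) = \<alpha> (inv \<beta> x)"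
  by (metis inv_beta alpha_beta_commute)

lemma untwist_twist: "m x y = untwist m (\<alpha> x) (\<beta> y)"
  by (simp add: untwist_def)

lemma alpha_untwist:
  assumes "\<And>x y. \<alpha> (m x y) = m (\<alpha> x) (\<alpha> y)"
  shows "\<alpha> (untwist m x y) = untwist m (\<alpha> x) (\<alpha> y)"
  by (simp add: untwist_def assms inv_beta_alpha)

lemma beta_untwist:
  assumes "\<And>x y. \<beta> (m x y) = m (\<beta> x) (\<beta> y)"
  shows "\<beta> (untwist m x y) = untwist m (\<beta> x) (\<beta> y)"
  by (simp add: untwist_def assms inv_alpha_beta)

lemma bilinear_map_untwist:
  assumes "bilinear_map scale m"
  shows "bilinear_map scale (untwist m)"
  unfolding untwist_def
  using assms linear_inv_of_bij[OF linear_alpha bij_alpha] linear_inv_of_bij[OF linear_beta bij_beta]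
  by (rule bilinear_map_compose)

lemmas untwist_endomorphism =
  alpha_untwist[of bracket, OF alpha_bracket] beta_untwist[of bracket, OF beta_bracket]
  alpha_untwist[of rhd, OF alpha_rhd] beta_untwist[of rhd, OF beta_rhd]

text \<open>
  Each identity is obtained by writing its variables as images under the monomials in \<open>\<alpha>\<close> and
  \<open>\<beta>\<close> that the BiHom identity produces.
\<close>

lemma post_lie_algebra_untwist: "post_lie_algebra scale (untwist bracket) (untwist rhd)"
proof
  let ?b = "untwist bracket" and ?r = "untwist rhd"
  show "bilinear_map scale ?b" "bilinear_map scale ?r"
    by (simp_all add: bilinear_map_untwist bilinear_bracket bilinear_rhd)
  note twist = untwist_twist[of bracket] untwist_twist[of rhd]
  note normalize = untwist_endomorphism alpha_beta_commute
  show "?b x y = - ?b y x" for x y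
  proof -
    obtain u v where "x = \<beta> (\<alpha> u)" "y = \<beta> (\<alpha> v)"
      using that[of "inv \<alpha> (inv \<beta> x)" "inv \<alpha> (inv \<beta> y)"] by simp
    then show ?thesis
      using bihom_skew_symmetry[of u v] by (simp add: twist normalize)
  qed
  show "?b x (?b y z) + ?b y (?b z x) + ?b z (?b x y) = 0" for x y z
  proof -
    obtain u v w where "x = \<beta> (\<beta> (\<alpha> u))" "y = \<beta> (\<beta> (\<alpha> v))" "z = \<beta> (\<beta> (\<alpha> w))"
      using that[of "inv \<alpha> (inv \<beta> (inv \<beta> x))" "inv \<alpha> (inv \<beta> (inv \<beta> y))"
            "inv \<alpha> (inv \<beta> (inv \<beta> z))"] by simp
    then show ?thesis
      using bihom_jacobi[of u v w] by (simp add: twist normalize)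
  qed
  show "?r x (?b y z) = ?b (?r x y) z + ?b y (?r x z)" for x y z
  proof -
    obtain u v w where "x = \<beta> (\<alpha> (\<alpha> u))" "y = \<beta> (\<alpha> v)" "z = \<beta> (\<beta> w)"
      using that[of "inv \<alpha> (inv \<alpha> (inv \<beta> x))" "inv \<alpha> (inv \<beta> y)" "inv \<beta> (inv \<beta> z)"] by simp
    then show ?thesis
      using rhd_bracket[of u v w] by (simp add: twist normalize)
  qed
  show "?r (?b x y) z = (?r x (?r y z) - ?r (?r x y) z) - (?r y (?r x z) - ?r (?r y x) z)" for x y z
  proof -
    obtain u v w where "x = \<beta> (\<alpha> (\<alpha> u))" "y = \<beta> (\<alpha> (\<alpha> v))" "z = \<beta> (\<beta> w)"
      using that[of "inv \<alpha> (inv \<alpha> (inv \<beta> x))" "inv \<alpha> (inv \<alpha> (inv \<beta> y))" "inv \<beta> (inv \<beta> z)"] by simp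
    then show ?thesis
      using bracket_rhd[of u v w] by (simp add: bihom_associator_def twist normalize)
  qed
qed

end

section \<open>The BiHom-Lie algebra of a regular BiHom-post-Lie algebra\<close>

theorem proposition3p5:
  fixes scale :: "'k::field_char_0 \<Rightarrow> 'a::ab_group_add \<Rightarrow> 'a"
    and bracket rhd :: "'a \<Rightarrow> 'a \<Rightarrow> 'a"
    and \<alpha> \<beta> :: "'a \<Rightarrow> 'a"
  assumes "regular_bihom_post_lie_algebra scale bracket rhd \<alpha> \<beta>"
  shows "bihom_lie_algebra scale
           (\<lambda>x y. rhd x y - rhd (inv \<alpha> (\<beta> y)) (\<alpha> (inv \<beta> x)) + bracket x y) \<alpha> \<beta>"
proof -
  interpret regular_bihom_post_lie_algebra scale bracket rhd \<alpha> \<beta>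
    by (fact assms)
  interpret U: post_lie_algebra scale "untwist bracket" "untwist rhd"
    by (fact post_lie_algebra_untwist)
  interpret L: lie_algebra scale U.sub_adjacent
    by (fact U.lie_algebra_sub_adjacent)
  interpret \<alpha>: Vector_Spaces.linear scale scale \<alpha>
    by (fact linear_alpha)
  interpret \<beta>: Vector_Spaces.linear scale scale \<beta>
    by (fact linear_beta)
  have "bihom_lie_algebra scale (\<lambda>x y. U.sub_adjacent (\<alpha> x) (\<beta> y)) \<alpha> \<beta>"
    using linear_alpha linear_beta alpha_beta_commute
    by (rule L.bihom_lie_algebra_twist) (simp_all add: U.sub_adjacent_def \<alpha>.add \<alpha>.diff \<beta>.add \<beta>.diff
        untwist_endomorphism)
  moreover have "U.sub_adjacent (\<alpha> x) (\<beta> y) =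
      rhd x y - rhd (inv \<alpha> (\<beta> y)) (\<alpha> (inv \<beta> x)) + bracket x y" for x y
    by (simp add: U.sub_adjacent_def untwist_def inv_beta_alpha)
  ultimately show ?thesis
    by simp
qed

end
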